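(* Consider an ensemble of $N$ electric water heaters over a control window $\mathcal{C}=[t_0,t_f)$ as described in the context, under assumptions A1 and A2. Let $P_\Sigma(t)=\sum_{i=1}^N s_i(t)P_i$, let $\overline{P_\Sigma}>0$ be the committed flexibility, and let $\xi(t|t_0):=\left|P_\Sigma(t)-\overline{P_\Sigma}\right|/\overline{P_\Sigma}$. Then the expected squared relative error between the actual and committed flexibility, for any $t\in\mathcal{C}$, is given by $$\mathbb{E}\lbrace \xi(t|t_0)^2\rbrace = \frac{N}{N-1}\left[1-\frac{\langle P^2\rangle}{2\overline{P_\Sigma}\langle P\rangle}-p_{on}(t)(N-1)\frac{\langle P\rangle}{\overline{P_\Sigma}}\right]^2-\frac{N}{N-1}\left(1-\frac{\langle P^2\rangle}{2\overline{P_\Sigma}\langle P\rangle}\right)^2+1,$$ where $\langle P\rangle:=\mathbb{E}[P_i]$ for all $i$ and $\langle P^2\rangle:=\mathbb{E}[P_i^2]$ for all $i$.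
   Context: Ensemble model. There are $N$ electric water heaters (EWHs), indexed by $i\in\{1,\dots,N\}$. Each EWH has a water temperature $T_w(t)$ and a switching variable $s(t)\in\{0,1\}$ ($1$ = "on", $0$ = "off") with dynamics $\dot T_w(t)=-a(t)T_w(t)+b(s(t),t)$, where $a(t)=\frac{1}{C_w}(\dot m(t)C_p+W)$ and $b(s(t),t)=\frac{1}{C_w}(s(t)Q_e+\dot m(t)C_pT_{in}(t)+WT_a(t))$. Here $C_w$ is the thermal capacitance of the water, $C_p$ the specific heat capacity of water, $W$ the thermal conductance of the tank shell, $Q_e$ the heating capacity, $\dot m$ the hot water flow rate, $T_{in}$ the inlet water temperature and $T_a$ the room temperature. Switching rule: $s(t^+)=0$ if $T_w(t)\ge T_{set}+\delta T/2$; $s(t^+)=1$ if $T_w(t)\le T_{set}-\delta T/2$; $s(t^+)=s(t)$ otherwise, where $T_{set}$ is the set-point and $\delta T$ the deadband width. The $i$-th EWH draws constant power $P_i>0$ when on, so it consumes $s_i(t)P_i$ at time $t$. Initial conditions and parameters (including $P_i$) are random. Notation. $\mathcal{C}=[t_0,t_f)$ is the control window. $\mathcal{S}_t=\{i: s_i(t)=1\}$ is the set of indices of on EWHs at time $t$, and $|\mathcal{S}_t|$ is its cardinality. At $t_0$ each EWH communicates its consumption $s_i(t_0)P_i$ to an aggregator, so $|\mathcal{S}_{t_0}|$ is a known number. For $t\in\mathcal{C}$, $p_{on}(t):=\Pr(i\in\mathcal{S}_t)=\Pr(s_i(t)=1)$ is the probability that a randomly selected EWH is on at time $t$ (the same for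 all $i$), with $p_{on}(t_0)=|\mathcal{S}_{t_0}|/N$. The committed flexibility $\overline{P_\Sigma}$ is a deterministic number that the aggregator commits to as the maximum reduction of aggregate power over the window. Let $\Delta_{on}$ and $\Delta_{off}$ be the random lengths of a natural (unforced) on-period and off-period of an EWH. Assumptions. A1: the random variables representing the initial conditions and parameters of the EWHs are drawn from the same distribution and are independent of each other; consequently the on- and off-periods of every EWH follow common probability density functions $f_{\Delta_{on}}$ and $f_{\Delta_{off}}$. A2: the length of the control window is sufficiently small that each EWH changes its state of operation (on/off) at most once during the control window. *)

theory Defs
  imports "HOL-Probability.Probability"
begin

(* Initial conditions and thermal parameters of one water heater; the electric
   power P is kept separate.  The switching variable takes the real values 0 and 1. *)
record ewh =
  T_init :: real
  s_init :: real
  C_w :: real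
  C_p :: real
  W_shell :: real
  Q_e :: real
  m_dot :: "real \<Rightarrow> real"
  T_in :: "real \<Rightarrow> real"
  T_a :: "real \<Rightarrow> real"
  T_set :: real
  deadband :: real

(* The sigma-algebra generated by all components; a time-dependent component is
   measured through its values at fixed times. *)
definition ewh_space :: "ewh measure" where
  "ewh_space = vimage_algebra UNIV
     (\<lambda>d. (T_init d, s_init d, C_w d, C_p d, W_shell d, Q_e d,
           m_dot d, T_in d, T_a d, T_set d, deadband d))
     (borel \<Otimes>\<^sub>M borel \<Otimes>\<^sub>M borel \<Otimes>\<^sub>M borel \<Otimes>\<^sub>M borel \<Otimes>\<^sub>M borel \<Otimes>\<^sub>M
      PiM UNIV (\<lambda>_. borel) \<Otimes>\<^sub>M PiM UNIV (\<lambda>_. borel) \<Otimes>\<^sub>M PiM UNIV (\<lambda>_. borel) \<Otimes>\<^sub>M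
      borel \<Otimes>\<^sub>M borel)"

definition coeff_a :: "ewh \<Rightarrow> real \<Rightarrow> real" where
  "coeff_a d t = 1 / C_w d * (m_dot d t * C_p d + W_shell d)"

definition coeff_b :: "ewh \<Rightarrow> real \<Rightarrow> real \<Rightarrow> real" where
  "coeff_b d \<sigma> t =
     1 / C_w d * (\<sigma> * Q_e d + m_dot d t * C_p d * T_in d t + W_shell d * T_a d t)"

(* Piecewise continuity: enough regularity for the differential equation to make
   sense, allowing jumps such as hot water draws that start and stop abruptly. *)
definition regular_input :: "real \<Rightarrow> real \<Rightarrow> (real \<Rightarrow> real) \<Rightarrow> bool" where
  "regular_input t0 tf f \<longleftrightarrow>
     (\<forall>t\<in>{t0..<tf}. bounded (f ` {t0..t})) \<and>
     (\<exists>K. finite K \<and> (\<forall>t\<in>{t0..<tf} - K. continuous (at t within {t0..<tf}) f))"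

definition admissible :: "real \<Rightarrow> real \<Rightarrow> ewh \<Rightarrow> bool" where
  "admissible t0 tf d \<longleftrightarrow>
     0 < C_w d \<and> 0 < deadband d \<and>
     regular_input t0 tf (m_dot d) \<and> regular_input t0 tf (T_in d) \<and> regular_input t0 tf (T_a d)"

(* The right-hand side jumps at switching instants and at jumps of the inputs, so
   the temperature is continuous and satisfies the differential equation outside a
   finite set of times. *)
definition temperature_dynamics ::
  "real \<Rightarrow> real \<Rightarrow> ewh \<Rightarrow> (real \<Rightarrow> real) \<Rightarrow> (real \<Rightarrow> real) \<Rightarrow> bool" where
  "temperature_dynamics t0 tf d T s \<longleftrightarrow>
     T t0 = T_init d \<and> continuous_on {t0..<tf} T \<and>
     (\<exists>K. finite K \<and> (\<forall>t\<in>{t0..<tf} - K.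
        (T has_real_derivative (- coeff_a d t * T t + coeff_b d (s t) t)) (at t within {t0..<tf})))"

(* s(t) is the value before a switch at time t and s(t+) the value after it: s is
   left-continuous and the switching rule prescribes its right limits. *)
definition switching_rule ::
  "real \<Rightarrow> real \<Rightarrow> ewh \<Rightarrow> (real \<Rightarrow> real) \<Rightarrow> (real \<Rightarrow> real) \<Rightarrow> bool" where
  "switching_rule t0 tf d T s \<longleftrightarrow>
     s t0 = s_init d \<and> (\<forall>t\<in>{t0..<tf}. s t \<in> {0, 1}) \<and>
     (\<forall>t\<in>{t0<..<tf}. (s \<longlongrightarrow> s t) (at_left t)) \<and>
     (\<forall>t\<in>{t0..<tf}.
        (s \<longlongrightarrow> (if T t \<ge> T_set d + deadband d / 2 then 0
              else if T t \<le> T_set d - deadband d / 2 then 1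
              else s t)) (at_right t))"

definition switches_at :: "(real \<Rightarrow> real) \<Rightarrow> real \<Rightarrow> bool" where
  "switches_at s t \<longleftrightarrow> \<not> (s \<longlongrightarrow> s t) (at_right t)"

definition at_most_one_switch :: "real \<Rightarrow> real \<Rightarrow> (real \<Rightarrow> real) \<Rightarrow> bool" where
  "at_most_one_switch t0 tf s \<longleftrightarrow>
     (\<forall>u\<in>{t0..<tf}. \<forall>v\<in>{t0..<tf}. switches_at s u \<and> switches_at s v \<longrightarrow> u = v)"

(* Heaters are identically distributed and independent of each other, and the power
   of a heater is independent of its initial conditions and thermal parameters.
   Dependence among the components of X i is allowed. *)
definition iid_heaters ::
  "'w measure \<Rightarrow> nat \<Rightarrow> (nat \<Rightarrow> 'w \<Rightarrow> ewh) \<Rightarrow> (nat \<Rightarrow> 'w \<Rightarrow> real) \<Rightarrow> bool" where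
  "iid_heaters M N X P \<longleftrightarrow>
     (\<forall>i\<in>{1..N}. \<forall>j\<in>{1..N}.
        distr M (ewh_space \<Otimes>\<^sub>M borel) (\<lambda>\<omega>. (X i \<omega>, P i \<omega>)) =
        distr M (ewh_space \<Otimes>\<^sub>M borel) (\<lambda>\<omega>. (X j \<omega>, P j \<omega>))) \<and>
     prob_space.indep_vars M (\<lambda>_. ewh_space \<Otimes>\<^sub>M borel) (\<lambda>i \<omega>. (X i \<omega>, P i \<omega>)) {1..N} \<and>
     (\<forall>i\<in>{1..N}. prob_space.indep_set M
        (sets (vimage_algebra (space M) (X i) ewh_space))
        (sets (vimage_algebra (space M) (P i) borel)))"

definition on_set :: "nat \<Rightarrow> (nat \<Rightarrow> 'w \<Rightarrow> real \<Rightarrow> real) \<Rightarrow> real \<Rightarrow> 'w \<Rightarrow> nat set" where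
  "on_set N s t \<omega> = {i \<in> {1..N}. s i \<omega> t = 1}"

(* The same for all i in {1..N} when the heaters are identically distributed.  The
   number of heaters reported as on at t0 is on_set evaluated at the realised outcome:
   an almost surely constant cardinality would contradict the independence of the
   heaters unless all of them are on or all are off. *)
definition p_on ::
  "'w measure \<Rightarrow> nat \<Rightarrow> (nat \<Rightarrow> 'w \<Rightarrow> real \<Rightarrow> real) \<Rightarrow> nat \<Rightarrow> real \<Rightarrow> real" where
  "p_on M N s i t = measure M {\<omega> \<in> space M. i \<in> on_set N s t \<omega>}"

definition aggregate_power ::
  "nat \<Rightarrow> (nat \<Rightarrow> 'w \<Rightarrow> real) \<Rightarrow> (nat \<Rightarrow> 'w \<Rightarrow> real \<Rightarrow> real) \<Rightarrow> real \<Rightarrow> 'w \<Rightarrow> real" where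
  "aggregate_power N P s t \<omega> = (\<Sum>i=1..N. s i \<omega> t * P i \<omega>)"

definition relative_error ::
  "nat \<Rightarrow> (nat \<Rightarrow> 'w \<Rightarrow> real) \<Rightarrow> (nat \<Rightarrow> 'w \<Rightarrow> real \<Rightarrow> real) \<Rightarrow> real \<Rightarrow> real \<Rightarrow> 'w \<Rightarrow> real" where
  "relative_error N P s Pbar t \<omega> = \<bar>aggregate_power N P s t \<omega> - Pbar\<bar> / Pbar"

end

(* The temperature and the switching variable determine each other, so the state s i t is not a given
   random variable; the point is that it is a measurable function of the data X i alone. As long as no
   switch has occurred, the temperature is the explicit solution of a linear equation with s frozen at
   its initial value, and by A2 the state at time t differs from the initial one iff this explicit
   solution reaches the relevant threshold before t. The explicit solution is measurable in the data
   because piecewise continuous inputs are recovered, outside a finite set, from their values at dyadic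
   times. Hence s i t is independent of P i, the consumptions s i t * P i are independent and
   identically distributed over i, and s^2 = s gives them the second moment p_on <P^2>. Expanding the
   square of the sum yields the formula. *)
theory Submission
  imports Defs
begin

subsection \<open>Measurability of the unswitched temperature\<close>

text \<open>Reads \<open>f\<close> at dyadic times only, so that for random inputs just countably
  many coordinates enter. Where the sequence diverges, \<open>lim\<close> returns one fixed
  value.\<close>

definition dyadic_limit :: "(real \<Rightarrow> real) \<Rightarrow> real \<Rightarrow> real" where
  "dyadic_limit f x = lim (\<lambda>n. f (of_int \<lfloor>x * 2 ^ n\<rfloor> / 2 ^ n))"

lemma dyadic_floor_tendsto: "(\<lambda>n. of_int \<lfloor>x * 2 ^ n\<rfloor> / 2 ^ n) \<longlonglongrightarrow> (x::real)"
proof (rule tendsto_sandwich)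
  show "eventually (\<lambda>n. x - (1 / 2) ^ n \<le> of_int \<lfloor>x * 2 ^ n\<rfloor> / 2 ^ n) sequentially"
  proof (rule always_eventually, rule allI)
    fix n :: nat
    have "x * 2 ^ n - 1 \<le> of_int \<lfloor>x * 2 ^ n\<rfloor>" by linarith
    then have "(x * 2 ^ n - 1) / 2 ^ n \<le> of_int \<lfloor>x * 2 ^ n\<rfloor> / 2 ^ n"
      by (rule divide_right_mono) simp
    then show "x - (1 / 2) ^ n \<le> of_int \<lfloor>x * 2 ^ n\<rfloor> / 2 ^ n"
      by (simp add: diff_divide_distrib power_one_over)
  qed
  show "eventually (\<lambda>n. of_int \<lfloor>x * 2 ^ n\<rfloor> / 2 ^ n \<le> x) sequentially"
    by (rule always_eventually) (simp add: pos_divide_le_eq)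
  have "(\<lambda>n. x - (1 / 2) ^ n) \<longlonglongrightarrow> x - 0"
    by (intro tendsto_intros LIMSEQ_power_zero) simp
  then show "(\<lambda>n. x - (1 / 2) ^ n) \<longlonglongrightarrow> x" by simp
qed simp

text \<open>The approximants reach \<open>x\<close> from the left, hence the strict
  \<open>a < x\<close>: for \<open>x = a\<close> they may leave the interval on which
  \<open>f\<close> is known to be continuous.\<close>

lemma dyadic_limit_eq:
  assumes "continuous (at x within {a..<b}) f" "a < x" "x < b"
  shows "dyadic_limit f x = f x"
proof -
  have "eventually (\<lambda>n. of_int \<lfloor>x * 2 ^ n\<rfloor> / 2 ^ n \<in> {a<..<b}) sequentially"
    using dyadic_floor_tendsto by (rule topological_tendstoD) (use assms in auto)
  then have ev: "eventually (\<lambda>n. of_int \<lfloor>x * 2 ^ n\<rfloor> / 2 ^ n \<in> {a..<b}) sequentially"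
    by eventually_elim auto
  have "(\<lambda>n. f (of_int \<lfloor>x * 2 ^ n\<rfloor> / 2 ^ n)) \<longlonglongrightarrow> f x"
    by (rule continuous_within_tendsto_compose[OF assms(1) ev dyadic_floor_tendsto])
  then show ?thesis
    unfolding dyadic_limit_def by (rule limI)
qed

text \<open>Makes the coefficients jointly measurable in data and time. For admissible data it
  alters them at finitely many times of the window only, which no integral sees.\<close>

definition regularize :: "ewh \<Rightarrow> ewh" where
  "regularize d = d\<lparr>m_dot := dyadic_limit (m_dot d), T_in := dyadic_limit (T_in d),
                    T_a := dyadic_limit (T_a d)\<rparr>"

lemma coeff_regularize:
  "coeff_a (regularize d) v =
     1 / C_w d * (dyadic_limit (m_dot d) v * C_p d + W_shell d)"
  "coeff_b (regularize d) \<sigma> v =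
     1 / C_w d * (\<sigma> * Q_e d + dyadic_limit (m_dot d) v * C_p d * dyadic_limit (T_in d) v
       + W_shell d * dyadic_limit (T_a d) v)"
  by (simp_all add: coeff_a_def coeff_b_def regularize_def)

section \<open>Measurability of the components and coefficients\<close>

lemma ewh_components_measurable:
  "(\<lambda>d. (T_init d, s_init d, C_w d, C_p d, W_shell d, Q_e d,
           m_dot d, T_in d, T_a d, T_set d, deadband d)) \<in>
   ewh_space \<rightarrow>\<^sub>M (borel \<Otimes>\<^sub>M borel \<Otimes>\<^sub>M borel \<Otimes>\<^sub>M borel \<Otimes>\<^sub>M borel \<Otimes>\<^sub>M borel \<Otimes>\<^sub>M
      PiM UNIV (\<lambda>_. borel) \<Otimes>\<^sub>M PiM UNIV (\<lambda>_. borel) \<Otimes>\<^sub>M PiM UNIV (\<lambda>_. borel) \<Otimes>\<^sub>M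
      borel \<Otimes>\<^sub>M borel)"
  unfolding ewh_space_def
  by (rule measurable_vimage_algebra1) (auto simp: space_pair_measure space_PiM)

lemma measurable_ewh_parts:
  shows measurable_T_init [measurable]: "T_init \<in> borel_measurable ewh_space"
    and measurable_s_init [measurable]: "s_init \<in> borel_measurable ewh_space"
    and measurable_C_w [measurable]: "C_w \<in> borel_measurable ewh_space"
    and measurable_C_p [measurable]: "C_p \<in> borel_measurable ewh_space"
    and measurable_W_shell [measurable]: "W_shell \<in> borel_measurable ewh_space"
    and measurable_Q_e [measurable]: "Q_e \<in> borel_measurable ewh_space"
    and measurable_m_dot: "(\<lambda>d. m_dot d x) \<in> borel_measurable ewh_space"
    and measurable_T_in: "(\<lambda>d. T_in d x) \<in> borel_measurable ewh_space"
    and measurable_T_a: "(\<lambda>d. T_a d x) \<in> borel_measurable ewh_space"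
    and measurable_T_set [measurable]: "T_set \<in> borel_measurable ewh_space"
    and measurable_deadband [measurable]: "deadband \<in> borel_measurable ewh_space"
proof -
  note * = ewh_components_measurable
  \<comment> \<open>Peels the nested pairs one by one: \<open>c\<close>k is the k-th component and
    \<open>r\<close>k the tuple that remains, so \<open>r10\<close> is the last component.\<close>
  note c1 = measurable_compose[OF * measurable_fst] and r1 = measurable_compose[OF * measurable_snd]
  note c2 = measurable_compose[OF r1 measurable_fst] and r2 = measurable_compose[OF r1 measurable_snd]
  note c3 = measurable_compose[OF r2 measurable_fst] and r3 = measurable_compose[OF r2 measurable_snd]
  note c4 = measurable_compose[OF r3 measurable_fst] and r4 = measurable_compose[OF r3 measurable_snd]
  note c5 = measurable_compose[OF r4 measurable_fst] and r5 = measurable_compose[OF r4 measurable_snd]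
  note c6 = measurable_compose[OF r5 measurable_fst] and r6 = measurable_compose[OF r5 measurable_snd]
  note c7 = measurable_compose[OF r6 measurable_fst] and r7 = measurable_compose[OF r6 measurable_snd]
  note c8 = measurable_compose[OF r7 measurable_fst] and r8 = measurable_compose[OF r7 measurable_snd]
  note c9 = measurable_compose[OF r8 measurable_fst] and r9 = measurable_compose[OF r8 measurable_snd]
  note c10 = measurable_compose[OF r9 measurable_fst] and r10 = measurable_compose[OF r9 measurable_snd]
  have ev: "(\<lambda>f. f x) \<in> borel_measurable (PiM UNIV (\<lambda>_::real. borel :: real measure))"
    by (rule measurable_component_singleton) simp
  show "T_init \<in> borel_measurable ewh_space" "s_init \<in> borel_measurable ewh_space"
    "C_w \<in> borel_measurable ewh_space" "C_p \<in> borel_measurable ewh_space"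
    "W_shell \<in> borel_measurable ewh_space" "Q_e \<in> borel_measurable ewh_space"
    "T_set \<in> borel_measurable ewh_space" "deadband \<in> borel_measurable ewh_space"
    using c1 c2 c3 c4 c5 c6 c10 r10 by (simp_all add: eta_contract_eq)
  show "(\<lambda>d. m_dot d x) \<in> borel_measurable ewh_space"
    "(\<lambda>d. T_in d x) \<in> borel_measurable ewh_space"
    "(\<lambda>d. T_a d x) \<in> borel_measurable ewh_space"
    using measurable_compose[OF c7 ev] measurable_compose[OF c8 ev] measurable_compose[OF c9 ev]
    by simp_all
qed

text \<open>Evaluating a component at a random time is not measurable for the product sigma-algebra;
  at dyadic times only countably many coordinates are involved.\<close>

lemma measurable_dyadic_limit:
  assumes "\<And>x. (\<lambda>d. h d x) \<in> borel_measurable M"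
  shows "(\<lambda>(d, v). dyadic_limit (h d) v) \<in> borel_measurable (M \<Otimes>\<^sub>M borel)"
proof -
  have "(\<lambda>(d, v::real). h d (of_int \<lfloor>v * 2 ^ n\<rfloor> / 2 ^ n)) \<in> borel_measurable (M \<Otimes>\<^sub>M borel)" for n
  proof -
    have "(\<lambda>p :: _ \<times> real. h (fst p) (of_int \<lfloor>snd p * 2 ^ n\<rfloor> / 2 ^ n)) \<in> borel_measurable (M \<Otimes>\<^sub>M borel)"
    proof (rule measurable_compose_countable
        [where f = "\<lambda>k p. h (fst p) (of_int k / 2 ^ n)" and g = "\<lambda>p. \<lfloor>snd p * 2 ^ n\<rfloor>"])
      fix k :: int
      show "(\<lambda>p. h (fst p) (of_int k / 2 ^ n)) \<in> borel_measurable (M \<Otimes>\<^sub>M (borel :: real measure))"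
        by (rule measurable_compose[OF measurable_fst assms])
    qed measurable
    then show ?thesis by (simp add: split_beta)
  qed
  then have "(\<lambda>p. lim (\<lambda>n. (\<lambda>(d, v::real). h d (of_int \<lfloor>v * 2 ^ n\<rfloor> / 2 ^ n)) p))
      \<in> borel_measurable (M \<Otimes>\<^sub>M borel)"
    by (rule borel_measurable_lim_metric)
  then show ?thesis by (simp add: split_beta dyadic_limit_def)
qed

lemmas measurable_inputs =
  measurable_dyadic_limit[OF measurable_m_dot] measurable_dyadic_limit[OF measurable_T_in]
  measurable_dyadic_limit[OF measurable_T_a]

lemma measurable_coeff_a:
  "(\<lambda>(d, v). coeff_a (regularize d) v) \<in> borel_measurable (ewh_space \<Otimes>\<^sub>M borel)"
proof -
  note [measurable] = measurable_inputs
  show ?thesis unfolding coeff_regularize by measurable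
qed

lemma measurable_coeff_b:
  "(\<lambda>(d, v). coeff_b (regularize d) (s_init d) v) \<in> borel_measurable (ewh_space \<Otimes>\<^sub>M borel)"
proof -
  note [measurable] = measurable_inputs
  show ?thesis unfolding coeff_regularize by measurable
qed

text \<open>The moving endpoint \<open>u\<close> enters the integrand as an indicator, so the
  integral becomes one over the whole line with the parameter \<open>(d, u)\<close>.\<close>

lemma measurable_indefinite_integral:
  fixes f :: "'a \<Rightarrow> real \<Rightarrow> real"
  assumes [measurable]: "(\<lambda>(d, v). f d v) \<in> borel_measurable (M \<Otimes>\<^sub>M borel)"
  shows "(\<lambda>(d, u). LINT v:{a..u}|lborel. f d v) \<in> borel_measurable (M \<Otimes>\<^sub>M borel)"
proof -
  have "(\<lambda>p. LINT v|lborel. (if a \<le> v \<and> v \<le> snd p then f (fst p) v else 0))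
      \<in> borel_measurable (M \<Otimes>\<^sub>M borel)"
    by (rule lborel.borel_measurable_lebesgue_integral) measurable
  also have "(\<lambda>p. LINT v|lborel. (if a \<le> v \<and> v \<le> snd p then f (fst p) v else 0))
      = (\<lambda>(d, u). LINT v:{a..u}|lborel. f d v)"
    unfolding set_lebesgue_integral_def
    by (auto simp: fun_eq_iff split_beta intro!: Bochner_Integration.integral_cong)
  finally show ?thesis .
qed

text \<open>Exponent of the integrating factor. The Lebesgue integral of the regularized coefficient
  gives measurability over all data; for admissible data it agrees with the integral of
  \<open>coeff_a\<close>.\<close>

definition decay_exponent :: "real \<Rightarrow> ewh \<Rightarrow> real \<Rightarrow> real" where
  "decay_exponent t0 d u = (LINT v:{t0..u}|lborel. coeff_a (regularize d) v)"

text \<open>Variation of constants for the temperature equation with the switching variable frozen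
  at its initial value.\<close>

definition unswitched_temperature :: "real \<Rightarrow> ewh \<Rightarrow> real \<Rightarrow> real" where
  "unswitched_temperature t0 d u = exp (- decay_exponent t0 d u) *
     (T_init d + (LINT v:{t0..u}|lborel.
        exp (decay_exponent t0 d v) * coeff_b (regularize d) (s_init d) v))"

lemma measurable_decay_exponent [measurable]:
  "(\<lambda>(d, u). decay_exponent t0 d u) \<in> borel_measurable (ewh_space \<Otimes>\<^sub>M borel)"
  unfolding decay_exponent_def by (rule measurable_indefinite_integral[OF measurable_coeff_a])

lemma measurable_forcing:
  "(\<lambda>(d, v). exp (decay_exponent t0 d v) * coeff_b (regularize d) (s_init d) v)
     \<in> borel_measurable (ewh_space \<Otimes>\<^sub>M borel)"
proof -
  note [measurable] = measurable_coeff_b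
  show ?thesis by measurable
qed

lemma measurable_unswitched_temperature [measurable]:
  "(\<lambda>d. unswitched_temperature t0 d u) \<in> borel_measurable ewh_space"
proof -
  note [measurable] = measurable_indefinite_integral[OF measurable_forcing[of t0], of t0]
  show ?thesis unfolding unswitched_temperature_def by measurable
qed

subsection \<open>Regular inputs and the linear equation\<close>

lemma regular_input_const: "regular_input a b (\<lambda>_. c)"
  unfolding regular_input_def by (auto simp: image_constant_conv intro!: exI[of _ "{}"])

lemma regular_input_add:
  assumes "regular_input a b f" "regular_input a b g"
  shows "regular_input a b (\<lambda>x. f x + g x)"
proof -
  obtain K where K: "finite K" "\<forall>t\<in>{a..<b} - K. continuous (at t within {a..<b}) f"
    using assms(1) unfolding regular_input_def by blast
  obtain L where L: "finite L" "\<forall>t\<in>{a..<b} - L. continuous (at t within {a..<b}) g"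
    using assms(2) unfolding regular_input_def by blast
  have "bounded ((\<lambda>x. f x + g x) ` {a..t})" if "t \<in> {a..<b}" for t
    using assms that unfolding regular_input_def by (intro bounded_plus_comp) auto
  then show ?thesis
    unfolding regular_input_def using K L
    by (auto intro!: exI[of _ "K \<union> L"] continuous_add)
qed

lemma regular_input_mult:
  assumes "regular_input a b f" "regular_input a b g"
  shows "regular_input a b (\<lambda>x. f x * g x)"
proof -
  obtain K where K: "finite K" "\<forall>t\<in>{a..<b} - K. continuous (at t within {a..<b}) f"
    using assms(1) unfolding regular_input_def by blast
  obtain L where L: "finite L" "\<forall>t\<in>{a..<b} - L. continuous (at t within {a..<b}) g"
    using assms(2) unfolding regular_input_def by blast
  have "bounded ((\<lambda>x. f x * g x) ` {a..t})" if t: "t \<in> {a..<b}" for t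
  proof -
    obtain B C where B: "\<And>x. x \<in> {a..t} \<Longrightarrow> \<bar>f x\<bar> \<le> B" and C: "\<And>x. x \<in> {a..t} \<Longrightarrow> \<bar>g x\<bar> \<le> C"
      using assms t unfolding regular_input_def bounded_iff by fastforce
    have "\<bar>f x * g x\<bar> \<le> B * C" if "x \<in> {a..t}" for x
      unfolding abs_mult using B[OF that] C[OF that] by (intro mult_mono) auto
    then show ?thesis unfolding bounded_iff by (intro exI[of _ "B * C"]) auto
  qed
  then show ?thesis
    unfolding regular_input_def using K L
    by (auto intro!: exI[of _ "K \<union> L"] continuous_mult)
qed

text \<open>A regular input may blow up at \<open>b\<close>; boundedness is asked on the compact
  intervals \<open>{a..t}\<close>, where continuity provides it.\<close>

lemma regular_input_continuous:
  assumes "continuous_on {a..<b} f"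
  shows "regular_input a b f"
proof -
  have "bounded (f ` {a..t})" if "t \<in> {a..<b}" for t
    using that by (intro compact_imp_bounded compact_continuous_image
      continuous_on_subset[OF assms]) auto
  then show ?thesis
    unfolding regular_input_def
    using assms by (auto intro!: exI[of _ "{}"] simp: continuous_on_eq_continuous_within)
qed

lemma dyadic_limit_regular_input:
  assumes "regular_input a b f"
  obtains K where "finite K" "\<And>v. v \<in> {a..<b} - K \<Longrightarrow> dyadic_limit f v = f v"
proof -
  obtain K where K: "finite K" "\<forall>t\<in>{a..<b} - K. continuous (at t within {a..<b}) f"
    using assms(1) unfolding regular_input_def by blast
  show ?thesis
    \<comment> \<open>The left endpoint joins the exceptional set because its dyadic approximants
      may lie outside the window.\<close>
    by (rule that[of "insert a K"]) (use K in \<open>auto intro!: dyadic_limit_eq[where a=a and b=b]\<close>)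
qed

text \<open>Bridge between the Lebesgue integral, used for measurability in the data, and the gauge
  integral, used for calculus. The Borel function \<open>g\<close> is bounded almost everywhere on
  \<open>{a..u}\<close>, hence integrable, and finitely many points do not affect the
  integral.\<close>

lemma regular_input_integral:
  assumes f: "regular_input a b f" and K: "finite K" "\<And>v. v \<in> {a..<b} - K \<Longrightarrow> g v = f v"
    and g [measurable]: "g \<in> borel_measurable borel" and u: "u \<in> {a..<b}"
  shows "f integrable_on {a..u}" "(LINT v:{a..u}|lborel. g v) = integral {a..u} f"
proof -
  obtain B where B: "\<And>x. x \<in> {a..u} \<Longrightarrow> norm (f x) \<le> B"
    using f u unfolding regular_input_def bounded_iff by fastforce
  have "AE x in lborel. x \<notin> K"
    by (rule AE_not_in) (rule finite_imp_null_set_lborel[OF K(1)])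
  then have bnd: "AE x in lborel. x \<in> {a..u} \<longrightarrow> norm (indicator {a..u} x *\<^sub>R g x) \<le> B"
    by eventually_elim (use B K u in auto)
  have set_int: "set_integrable lborel {a..u} g"
    unfolding set_integrable_def
    by (rule integrableI_bounded_set[where A = "{a..u}", OF _ _ _ bnd]) (auto simp: emeasure_lborel_Icc_eq)
  have eq: "f x = g x" if "x \<in> {a..u} - K" for x
    using K(2)[of x] u that by auto
  show "f integrable_on {a..u}"
    by (rule integrable_spike_finite[OF K(1) eq set_borel_integral_eq_integral(1)[OF set_int]])
  show "(LINT v:{a..u}|lborel. g v) = integral {a..u} f"
    unfolding set_borel_integral_eq_integral(2)[OF set_int]
    by (rule integral_spike[OF negligible_finite[OF K(1)] eq])
qed

text \<open>Integrating factor: off \<open>K\<close> the derivative of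
  \<open>exp (A v) * T v\<close> is \<open>exp (A v) * \<beta> v\<close>, and the fundamental
  theorem of calculus tolerates a finite exceptional set because this product is continuous.\<close>

lemma linear_ode_solution:
  fixes \<alpha> \<beta> T :: "real \<Rightarrow> real"
  assumes "finite K" "t0 \<le> u"
    and cont_T: "continuous_on {t0..u} T"
    and int_\<alpha>: "\<alpha> integrable_on {t0..u}"
    and cont_\<alpha>: "\<And>v. v \<in> {t0<..<u} - K \<Longrightarrow> isCont \<alpha> v"
    and ode: "\<And>v. v \<in> {t0<..<u} - K \<Longrightarrow> (T has_real_derivative - \<alpha> v * T v + \<beta> v) (at v)"
  defines "A \<equiv> \<lambda>v. integral {t0..v} \<alpha>"
  shows "T u = exp (- A u) * (T t0 + integral {t0..u} (\<lambda>v. exp (A v) * \<beta> v))"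
proof -
  have cont_A: "continuous_on {t0..u} A"
    unfolding A_def by (rule indefinite_integral_continuous_1[OF int_\<alpha>])
  have A': "(A has_real_derivative \<alpha> v) (at v)" if v: "v \<in> {t0<..<u} - K" for v
  proof -
    have "(A has_vector_derivative \<alpha> v) (at v within {t0..u} - {})"
      unfolding A_def
      by (rule integral_has_vector_derivative_continuous_at[OF int_\<alpha>])
        (use v continuous_at_imp_continuous_at_within[OF cont_\<alpha>[OF v]] in auto)
    then show ?thesis
      using v by (simp add: at_within_Icc_at has_real_derivative_iff_has_vector_derivative)
  qed
  have "((\<lambda>v. exp (A v) * \<beta> v) has_integral exp (A u) * T u - exp (A t0) * T t0) {t0..u}"
  proof (rule fundamental_theorem_of_calculus_interior_strong[OF \<open>finite K\<close> \<open>t0 \<le> u\<close>])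
    fix v assume v: "v \<in> {t0<..<u} - K"
    have "((\<lambda>v. exp (A v) * T v) has_real_derivative exp (A v) * \<beta> v) (at v)"
      by (auto intro!: derivative_eq_intros A'[OF v] ode[OF v] simp: algebra_simps)
    then show "((\<lambda>v. exp (A v) * T v) has_vector_derivative exp (A v) * \<beta> v) (at v)"
      by (simp add: has_real_derivative_iff_has_vector_derivative)
  qed (intro continuous_intros cont_A cont_T)
  then have "integral {t0..u} (\<lambda>v. exp (A v) * \<beta> v) = exp (A u) * T u - T t0"
    by (simp add: integral_unique A_def)
  then show ?thesis by (simp add: exp_minus)
qed

section \<open>The explicit solution for admissible data\<close>

lemma regular_coeff_a:
  assumes "admissible t0 tf d"
  shows "regular_input t0 tf (coeff_a d)"
proof -
  have "regular_input t0 tf (\<lambda>v. 1 / C_w d * (m_dot d v * C_p d + W_shell d))"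
    using assms unfolding admissible_def
    by (intro regular_input_mult regular_input_add regular_input_const) auto
  then show ?thesis by (simp add: coeff_a_def[abs_def])
qed

lemma regular_coeff_b:
  assumes "admissible t0 tf d"
  shows "regular_input t0 tf (coeff_b d \<sigma>)"
proof -
  have "regular_input t0 tf
      (\<lambda>v. 1 / C_w d * (\<sigma> * Q_e d + m_dot d v * C_p d * T_in d v + W_shell d * T_a d v))"
    using assms unfolding admissible_def
    by (intro regular_input_mult regular_input_add regular_input_const) auto
  then show ?thesis by (simp add: coeff_b_def[abs_def])
qed

lemma coeff_regularize_eq:
  assumes "admissible t0 tf d"
  obtains K where "finite K"
    "\<And>v. v \<in> {t0..<tf} - K \<Longrightarrow> coeff_a (regularize d) v = coeff_a d v"
    "\<And>v \<sigma>. v \<in> {t0..<tf} - K \<Longrightarrow> coeff_b (regularize d) \<sigma> v = coeff_b d \<sigma> v"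
proof -
  have reg: "regular_input t0 tf (m_dot d)" "regular_input t0 tf (T_in d)" "regular_input t0 tf (T_a d)"
    using assms by (auto simp: admissible_def)
  obtain K1 where K1: "finite K1" "\<And>v. v \<in> {t0..<tf} - K1 \<Longrightarrow> dyadic_limit (m_dot d) v = m_dot d v"
    by (rule dyadic_limit_regular_input[OF reg(1)]) blast
  obtain K2 where K2: "finite K2" "\<And>v. v \<in> {t0..<tf} - K2 \<Longrightarrow> dyadic_limit (T_in d) v = T_in d v"
    by (rule dyadic_limit_regular_input[OF reg(2)]) blast
  obtain K3 where K3: "finite K3" "\<And>v. v \<in> {t0..<tf} - K3 \<Longrightarrow> dyadic_limit (T_a d) v = T_a d v"
    by (rule dyadic_limit_regular_input[OF reg(3)]) blast
  show ?thesis
    by (rule that[of "K1 \<union> K2 \<union> K3"])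
      (use K1 K2 K3 in \<open>auto simp: regularize_def coeff_a_def coeff_b_def\<close>)
qed

lemma decay_exponent_eq:
  assumes "admissible t0 tf d" "u \<in> {t0..<tf}"
  shows "coeff_a d integrable_on {t0..u}" "decay_exponent t0 d u = integral {t0..u} (coeff_a d)"
proof -
  obtain K where K: "finite K" "\<And>v. v \<in> {t0..<tf} - K \<Longrightarrow> coeff_a (regularize d) v = coeff_a d v"
    by (rule coeff_regularize_eq[OF assms(1)]) blast
  have m: "coeff_a (regularize d) \<in> borel_measurable borel"
    using measurable_compose_Pair1[OF _ measurable_coeff_a, of d]
    by (simp add: ewh_space_def space_vimage_algebra)
  note * = regular_input_integral[OF regular_coeff_a[OF assms(1)] K m assms(2)]
  show "coeff_a d integrable_on {t0..u}" "decay_exponent t0 d u = integral {t0..u} (coeff_a d)"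
    using * by (simp_all add: decay_exponent_def)
qed

text \<open>Continuity is local: near \<open>x\<close> the half-open interval looks like
  \<open>{a..u}\<close> for any \<open>u\<close> strictly between \<open>x\<close> and
  \<open>b\<close>. This handles integrals that are controlled only up to times before the end of
  the window.\<close>

lemma continuous_on_Ico_if_Icc:
  fixes f :: "real \<Rightarrow> real"
  assumes "\<And>u. u \<in> {a..<b} \<Longrightarrow> continuous_on {a..u} f"
  shows "continuous_on {a..<b} f"
  unfolding continuous_on_eq_continuous_within
proof
  fix x assume x: "x \<in> {a..<b}"
  define u where "u = (x + b) / 2"
  have u: "x < u" "u < b" using x by (auto simp: u_def)
  have "continuous (at x within {a..u}) f"
    using assms[of u] u x by (auto simp: continuous_on_eq_continuous_within)
  moreover have "at x within {a..u} = at x within {a..<b}"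
    by (rule at_within_nhd[of _ "{..<u}"]) (use u in auto)
  ultimately show "continuous (at x within {a..<b}) f" by simp
qed

lemma continuous_indefinite_integral_Ico:
  fixes f :: "real \<Rightarrow> real"
  assumes "\<And>u. u \<in> {a..<b} \<Longrightarrow> f integrable_on {a..u}"
    and "\<And>u. u \<in> {a..<b} \<Longrightarrow> F u = integral {a..u} f"
  shows "continuous_on {a..<b} F"
proof (rule continuous_on_Ico_if_Icc)
  fix u assume u: "u \<in> {a..<b}"
  show "continuous_on {a..u} F"
    by (rule continuous_on_eq[OF indefinite_integral_continuous_1[OF assms(1)[OF u]]])
      (use assms(2) u in auto)
qed

lemma continuous_decay_exponent:
  assumes "admissible t0 tf d"
  shows "continuous_on {t0..<tf} (decay_exponent t0 d)"
  by (rule continuous_indefinite_integral_Ico[OF decay_exponent_eq[OF assms]])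

text \<open>The exponent is continuous in time, hence a regular input, and so is its product with
  the forcing coefficient.\<close>

lemma forcing_integral_eq:
  assumes "admissible t0 tf d" "u \<in> {t0..<tf}"
  shows "(\<lambda>v. exp (decay_exponent t0 d v) * coeff_b d (s_init d) v) integrable_on {t0..u}"
    and "(LINT v:{t0..u}|lborel. exp (decay_exponent t0 d v) * coeff_b (regularize d) (s_init d) v) =
       integral {t0..u} (\<lambda>v. exp (decay_exponent t0 d v) * coeff_b d (s_init d) v)"
proof -
  obtain K where K: "finite K"
    "\<And>v. v \<in> {t0..<tf} - K \<Longrightarrow> coeff_b (regularize d) (s_init d) v = coeff_b d (s_init d) v"
    by (rule coeff_regularize_eq[OF assms(1)]) blast
  have K': "exp (decay_exponent t0 d v) * coeff_b (regularize d) (s_init d) v =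
      exp (decay_exponent t0 d v) * coeff_b d (s_init d) v" if "v \<in> {t0..<tf} - K" for v
    using K(2)[OF that] by simp
  have r: "regular_input t0 tf (\<lambda>v. exp (decay_exponent t0 d v) * coeff_b d (s_init d) v)"
    by (intro regular_input_mult regular_coeff_b regular_input_continuous continuous_on_exp
      continuous_decay_exponent assms)
  have m: "(\<lambda>v. exp (decay_exponent t0 d v) * coeff_b (regularize d) (s_init d) v)
      \<in> borel_measurable borel"
    using measurable_compose_Pair1[OF _ measurable_forcing, of d]
    by (simp add: ewh_space_def space_vimage_algebra)
  note * = regular_input_integral[OF r K(1) K' m assms(2)]
  show "(\<lambda>v. exp (decay_exponent t0 d v) * coeff_b d (s_init d) v) integrable_on {t0..u}"
    by (rule *(1))
  show "(LINT v:{t0..u}|lborel. exp (decay_exponent t0 d v) * coeff_b (regularize d) (s_init d) v) =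
       integral {t0..u} (\<lambda>v. exp (decay_exponent t0 d v) * coeff_b d (s_init d) v)"
    by (rule *(2))
qed

lemma continuous_unswitched_temperature:
  assumes "admissible t0 tf d"
  shows "continuous_on {t0..<tf} (unswitched_temperature t0 d)"
proof -
  have "continuous_on {t0..<tf} (\<lambda>u. LINT v:{t0..u}|lborel.
      exp (decay_exponent t0 d v) * coeff_b (regularize d) (s_init d) v)"
    by (rule continuous_indefinite_integral_Ico[where f =
      "\<lambda>v. exp (decay_exponent t0 d v) * coeff_b d (s_init d) v"]) (fact forcing_integral_eq[OF assms])+
  then show ?thesis
    unfolding unswitched_temperature_def
    by (rule continuous_on_mult[OF continuous_on_exp[OF continuous_on_minus[OF
      continuous_decay_exponent[OF assms]]] continuous_on_add[OF continuous_on_const]])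
qed

text \<open>While \<open>s\<close> keeps its initial value the equation is linear with known
  coefficients, so its solution is the explicit one.\<close>

lemma temperature_eq_unswitched:
  assumes adm: "admissible t0 tf d" and dyn: "temperature_dynamics t0 tf d T s"
    and u: "u \<in> {t0..<tf}" and s: "\<And>v. v \<in> {t0..u} \<Longrightarrow> s v = s_init d"
  shows "T u = unswitched_temperature t0 d u"
proof -
  obtain K where K: "finite K" "\<And>v. v \<in> {t0..<tf} - K \<Longrightarrow>
      (T has_real_derivative (- coeff_a d v * T v + coeff_b d (s v) v)) (at v within {t0..<tf})"
    using dyn unfolding temperature_dynamics_def by blast
  obtain L where L: "finite L" "\<And>v. v \<in> {t0..<tf} - L \<Longrightarrow> continuous (at v within {t0..<tf}) (coeff_a d)"
    using regular_coeff_a[OF adm] unfolding regular_input_def by blast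
  \<comment> \<open>Such \<open>v\<close> are interior to the window, which turns one-sided
    derivatives and continuity into two-sided ones.\<close>
  have at: "at v within {t0..<tf} = at v" if "v \<in> {t0<..<u}" for v
    by (rule at_within_interior) (use that u in auto)
  have "T u = exp (- integral {t0..u} (coeff_a d)) *
      (T t0 + integral {t0..u} (\<lambda>v. exp (integral {t0..v} (coeff_a d)) * coeff_b d (s_init d) v))"
  proof (rule linear_ode_solution[where K = "K \<union> L"])
    show "continuous_on {t0..u} T"
      by (rule continuous_on_subset[of "{t0..<tf}"]) (use dyn u in \<open>auto simp: temperature_dynamics_def\<close>)
    show "coeff_a d integrable_on {t0..u}" by (rule decay_exponent_eq[OF adm u])
    fix v assume v: "v \<in> {t0<..<u} - (K \<union> L)"
    show "isCont (coeff_a d) v" using L(2)[of v] at[of v] v u by auto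
    show "(T has_real_derivative - coeff_a d v * T v + coeff_b d (s_init d) v) (at v)"
      using K(2)[of v] at[of v] s[of v] v u by auto
  qed (use K L u in auto)
  also have "T t0 = T_init d" using dyn by (simp add: temperature_dynamics_def)
  also have "integral {t0..u} (\<lambda>v. exp (integral {t0..v} (coeff_a d)) * coeff_b d (s_init d) v) =
      integral {t0..u} (\<lambda>v. exp (decay_exponent t0 d v) * coeff_b d (s_init d) v)"
    using u by (intro integral_cong) (simp add: decay_exponent_eq(2)[OF adm])
  finally show ?thesis
    unfolding unswitched_temperature_def forcing_integral_eq(2)[OF adm u] decay_exponent_eq(2)[OF adm u] .
qed

subsection \<open>The switching state as a function of the data\<close>

text \<open>Left continuity and the absence of switches make \<open>s\<close> continuous, and a
  continuous function with finitely many values on an interval is constant.\<close>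

lemma constant_between_switches:
  fixes s :: "real \<Rightarrow> real"
  assumes vals: "\<And>v. v \<in> {a..b} \<Longrightarrow> s v \<in> {0, 1}"
    and left: "\<And>v. v \<in> {a<..b} \<Longrightarrow> (s \<longlongrightarrow> s v) (at_left v)"
    and right: "\<And>v. v \<in> {a..<b} \<Longrightarrow> \<not> switches_at s v"
    and v: "v \<in> {a..b}"
  shows "s v = s a"
proof -
  have "continuous_on {a..b} s"
    unfolding continuous_on_def
  proof
    fix x assume x: "x \<in> {a..b}"
    have l: "(s \<longlongrightarrow> s x) (at x within {a..x})"
    proof (cases "a < x")
      case True
      then show ?thesis using left[of x] x by (simp add: at_within_Icc_at_left)
    \<comment> \<open>For \<open>x = a\<close> the filter is trivial, so any limit holds.\<close>
    qed (use x in \<open>auto simp: tendsto_def eventually_at_filter\<close>)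
    have r: "(s \<longlongrightarrow> s x) (at x within {x..b})"
    proof (cases "x < b")
      case True
      then show ?thesis
        using right[of x] x by (simp add: at_within_Icc_at_right switches_at_def)
    qed (use x in \<open>auto simp: tendsto_def eventually_at_filter\<close>)
    have "{a..b} = {a..x} \<union> {x..b}" using x by auto
    then show "(s \<longlongrightarrow> s x) (at x within {a..b})" using l r by (simp add: Lim_within_Un)
  qed
  moreover have "finite (s ` {a..b})" by (rule finite_subset[of _ "{0, 1}"]) (use vals in blast, simp)
  ultimately have "s constant_on {a..b}" by (intro continuous_finite_range_constant) auto
  then show ?thesis using v unfolding constant_on_def by auto
qed

text \<open>The two thresholds are merged into one inequality: the sign 2 * s_init d - 1
  selects the upper threshold for a heater that is on and the lower one for a heater that is off.\<close>

definition crosses_threshold :: "real \<Rightarrow> real \<Rightarrow> ewh \<Rightarrow> bool" where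
  "crosses_threshold t0 t d \<longleftrightarrow> (\<exists>u\<in>{t0..<t}.
     deadband d / 2 \<le> (2 * s_init d - 1) * (unswitched_temperature t0 d u - T_set d))"

text \<open>Up to the first switch the temperature is the explicit one, which decides whether and
  where that switch occurs; afterwards the state stays flipped, as no second switch follows. The
  crossing is sought before \<open>t\<close> only, since by left continuity a switch at
  \<open>t\<close> affects later values alone.\<close>

lemma switching_state_eq:
  assumes adm: "admissible t0 tf d" and dyn: "temperature_dynamics t0 tf d T s"
    and sw: "switching_rule t0 tf d T s" and once: "at_most_one_switch t0 tf s"
    and t: "t \<in> {t0..<tf}"
  shows "s t = (if crosses_threshold t0 t d then 1 - s_init d else s_init d)"
proof -
  have s0: "s t0 = s_init d" and vals: "\<And>v. v \<in> {t0..<tf} \<Longrightarrow> s v \<in> {0, 1}"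
    and left: "\<And>v. v \<in> {t0<..<tf} \<Longrightarrow> (s \<longlongrightarrow> s v) (at_left v)"
    and right: "\<And>v. v \<in> {t0..<tf} \<Longrightarrow> (s \<longlongrightarrow> (if T v \<ge> T_set d + deadband d / 2 then 0
              else if T v \<le> T_set d - deadband d / 2 then 1 else s v)) (at_right v)"
    using sw unfolding switching_rule_def by blast+
  have \<sigma>: "s_init d \<in> {0, 1}" using vals[of t0] s0 t by auto
  have db: "0 < deadband d" using adm by (simp add: admissible_def)
  have before: "s v = s_init d"
    if "u \<in> {t0..<tf}" "\<And>w. w \<in> {t0..<u} \<Longrightarrow> \<not> switches_at s w" "v \<in> {t0..u}" for u v
    using constant_between_switches[of t0 u s v] vals left s0 that by auto
  \<comment> \<open>A switch means that the prescribed right limit \<open>L\<close> differs from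
    \<open>s u\<close>. A heater that is on must reach the upper threshold, one that is off the
    lower; a positive deadband keeps the two apart.\<close>
  have switch_iff: "switches_at s u \<longleftrightarrow>
      deadband d / 2 \<le> (2 * s_init d - 1) * (unswitched_temperature t0 d u - T_set d)"
    if u: "u \<in> {t0..<tf}" and none: "\<And>w. w \<in> {t0..<u} \<Longrightarrow> \<not> switches_at s w" for u
  proof -
    define L where "L = (if T u \<ge> T_set d + deadband d / 2 then 0
              else if T u \<le> T_set d - deadband d / 2 then 1 else s u)"
    have "s u = s_init d" using before[OF u none, of u] u by auto
    moreover have "T u = unswitched_temperature t0 d u"
      using temperature_eq_unswitched[OF adm dyn u before[OF u none]] .
    moreover have "(s \<longlongrightarrow> L) (at_right u)" unfolding L_def by (rule right[OF u])
    then have "switches_at s u \<longleftrightarrow> L \<noteq> s u"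
      unfolding switches_at_def using tendsto_unique[OF trivial_limit_at_right_real] by auto
    ultimately show ?thesis
      using \<sigma> db by (auto simp: L_def split: if_splits)
  qed
  show ?thesis
  proof (cases "\<exists>u\<in>{t0..<t}. switches_at s u")
    case False
    then have none: "\<And>w. w \<in> {t0..<t} \<Longrightarrow> \<not> switches_at s w" by blast
    have "\<not> crosses_threshold t0 t d"
      unfolding crosses_threshold_def
    proof
      assume "\<exists>u\<in>{t0..<t}. deadband d / 2 \<le> (2 * s_init d - 1) * (unswitched_temperature t0 d u - T_set d)"
      then obtain u where "u \<in> {t0..<t}"
        "deadband d / 2 \<le> (2 * s_init d - 1) * (unswitched_temperature t0 d u - T_set d)" by blast
      with switch_iff[of u] none t show False by auto
    qed
    then show ?thesis using before[OF t none, of t] t by auto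
  next
    case True
    then obtain u where u: "u \<in> {t0..<t}" "switches_at s u" by blast
    have unique: "\<not> switches_at s w" if "w \<in> {t0..<tf}" "w \<noteq> u" for w
      using once u t that unfolding at_most_one_switch_def by auto
    have u': "u \<in> {t0..<tf}" using u t by auto
    have none: "\<And>w. w \<in> {t0..<u} \<Longrightarrow> \<not> switches_at s w" using unique u t by auto
    have "crosses_threshold t0 t d"
      unfolding crosses_threshold_def using switch_iff[OF u' none] u by blast
    moreover have "s t = 1 - s_init d"
    proof -
      \<comment> \<open>The state is constant on \<open>{u<..t}\<close>, so \<open>s t\<close> is
        the right limit at \<open>u\<close>; as \<open>u\<close> is a switch, it differs from
        \<open>s u\<close>.\<close>
      have const: "s v = s t" if "v \<in> {u<..t}" for v
        using constant_between_switches[of v t s t] vals left unique u t that by auto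
      have "eventually (\<lambda>v. v \<in> {u<..<t}) (at_right u)"
        using u by (intro eventually_at_right_real) auto
      then have "eventually (\<lambda>v. s v = s t) (at_right u)"
        by eventually_elim (rule const, simp)
      then have "(s \<longlongrightarrow> s t) (at_right u)" by (rule tendsto_eventually)
      then have "s t \<noteq> s u" using u(2) unfolding switches_at_def by auto
      moreover have "s u = s_init d" using before[OF u' none, of u] u by auto
      moreover have "s t \<in> {0, 1}" using vals t by auto
      ultimately show ?thesis using \<sigma> by auto
    qed
    ultimately show ?thesis by simp
  qed
qed

text \<open>Replaces a search over uncountably many times by countable operations. The bound
  \<open>1 / Suc n\<close> selects a compact subinterval, on which rational values arbitrarily close
  to \<open>c\<close> from below force the maximum to be at least \<open>c\<close>.\<close>

lemma exists_ge_Ico_iff_rational: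
  fixes f :: "real \<Rightarrow> real"
  assumes cont: "continuous_on {a..<b} f"
  shows "(\<exists>u\<in>{a..<b}. c \<le> f u) \<longleftrightarrow>
    (\<exists>n::nat. \<forall>k::nat. \<exists>q\<in>\<rat>. a \<le> q \<and> q \<le> b - 1 / Suc n \<and> c - 1 / Suc k < f q)"
proof
  assume "\<exists>u\<in>{a..<b}. c \<le> f u"
  then obtain u where u: "a \<le> u" "u < b" "c \<le> f u" by auto
  \<comment> \<open>Leaves room between \<open>u\<close> and the right end of the compact interval,
    so that a rational to the right of \<open>u\<close> fits in.\<close>
  obtain n where n: "1 / real (Suc n) < b - u"
    using reals_Archimedean[of "b - u"] u by (auto simp: inverse_eq_divide)
  have "\<exists>q\<in>\<rat>. a \<le> q \<and> q \<le> b - 1 / Suc n \<and> c - 1 / Suc k < f q" for k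
  proof -
    obtain e where e: "0 < e" "\<And>v. v \<in> {a..<b} \<Longrightarrow> dist v u < e \<Longrightarrow> dist (f v) (f u) < 1 / Suc k"
      using cont u unfolding continuous_on_iff
      by (metis atLeastLessThan_iff of_nat_0_less_iff zero_less_Suc zero_less_divide_1_iff)
    \<comment> \<open>Choosing the rational to the right of \<open>u\<close> secures
      \<open>a \<le> q\<close>, also when \<open>u = a\<close>.\<close>
    have "u < min (u + e) (b - 1 / Suc n)" using e n by auto
    then obtain q where q: "q \<in> \<rat>" "u < q" "q < min (u + e) (b - 1 / Suc n)"
      using Rats_dense_in_real by blast
    have "0 < 1 / real (Suc n)" by simp
    then have "q < b" using q by linarith
    then have "dist (f q) (f u) < 1 / Suc k" using e(2)[of q] q u by (auto simp: dist_real_def)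
    then show ?thesis using q u by (intro bexI[of _ q]) (auto simp: dist_real_def)
  qed
  then show "\<exists>n::nat. \<forall>k::nat. \<exists>q\<in>\<rat>. a \<le> q \<and> q \<le> b - 1 / Suc n \<and> c - 1 / Suc k < f q" by blast
next
  assume "\<exists>n::nat. \<forall>k::nat. \<exists>q\<in>\<rat>. a \<le> q \<and> q \<le> b - 1 / Suc n \<and> c - 1 / Suc k < f q"
  then obtain n :: nat where
    n: "\<And>k::nat. \<exists>q. a \<le> q \<and> q \<le> b - 1 / Suc n \<and> c - 1 / Suc k < f q" by blast
  have pos: "0 < 1 / real (Suc n)" by simp
  have "{a..b - 1 / Suc n} \<noteq> {}" using n by fastforce
  moreover have "continuous_on {a..b - 1 / Suc n} f"
    by (rule continuous_on_subset[OF cont]) (intro subsetI, unfold atLeastAtMost_iff atLeastLessThan_iff, use pos in linarith)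
  ultimately obtain w where w: "w \<in> {a..b - 1 / Suc n}" "\<And>v. v \<in> {a..b - 1 / Suc n} \<Longrightarrow> f v \<le> f w"
    using continuous_attains_sup[of "{a..b - 1 / Suc n}" f] by auto
  have "c \<le> f w"
  proof (rule ccontr)
    assume "\<not> c \<le> f w"
    then obtain k where k: "1 / real (Suc k) < c - f w"
      using reals_Archimedean[of "c - f w"] by (auto simp: inverse_eq_divide)
    obtain q where q: "a \<le> q" "q \<le> b - 1 / Suc n" "c - 1 / Suc k < f q" using n by blast
    then have "f q \<le> f w" by (intro w) auto
    with q k show False by linarith
  qed
  moreover have "w \<in> {a..<b}"
    using w(1) pos unfolding atLeastAtMost_iff atLeastLessThan_iff by linarith
  ultimately show "\<exists>u\<in>{a..<b}. c \<le> f u" by blast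
qed

text \<open>The state formula with the threshold crossing in countable form: measurable on all data,
  and equivalent to \<open>crosses_threshold\<close> wherever the explicit temperature is
  continuous.\<close>

definition switching_state :: "real \<Rightarrow> real \<Rightarrow> ewh \<Rightarrow> real" where
  "switching_state t0 t d =
     (if \<exists>n::nat. \<forall>k::nat. \<exists>q\<in>\<rat>. t0 \<le> q \<and> q \<le> t - 1 / Suc n \<and>
        deadband d / 2 - 1 / Suc k < (2 * s_init d - 1) * (unswitched_temperature t0 d q - T_set d)
      then 1 - s_init d else s_init d)"

lemma measurable_switching_state [measurable]:
  "switching_state t0 t \<in> borel_measurable ewh_space"
proof -
  have [simp]: "countable (\<rat> :: real set)" by (rule countable_rat)
  show ?thesis unfolding switching_state_def by measurable
qed

lemma switching_state_correct:
  assumes adm: "admissible t0 tf d" and "temperature_dynamics t0 tf d T s"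
    and "switching_rule t0 tf d T s" and "at_most_one_switch t0 tf s" and t: "t \<in> {t0..<tf}"
  shows "s t = switching_state t0 t d"
proof -
  have cont: "continuous_on {t0..<t} (\<lambda>u. (2 * s_init d - 1) * (unswitched_temperature t0 d u - T_set d))"
    by (intro continuous_intros continuous_on_subset[OF continuous_unswitched_temperature[OF adm]])
      (use t in auto)
  from switching_state_eq[OF assms] show ?thesis
    unfolding switching_state_def crosses_threshold_def exists_ge_Ico_iff_rational[OF cont, symmetric] .
qed

subsection \<open>Second moment of the aggregate power\<close>

context prob_space
begin

text \<open>The double sum splits into diagonal terms, each contributing \<open>\<nu>\<close>, and
  ordered off-diagonal pairs, which are uncorrelated and each contribute the squared mean.\<close>

lemma expectation_square_sum_minus:
  fixes Y :: "'i \<Rightarrow> 'a \<Rightarrow> real"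
  assumes fin: "finite I"
    and int: "\<And>j. j \<in> I \<Longrightarrow> integrable M (Y j)"
    and int2: "\<And>j k. j \<in> I \<Longrightarrow> k \<in> I \<Longrightarrow> integrable M (\<lambda>\<omega>. Y j \<omega> * Y k \<omega>)"
    and mean: "\<And>j. j \<in> I \<Longrightarrow> expectation (Y j) = \<mu>"
    and sq: "\<And>j. j \<in> I \<Longrightarrow> expectation (\<lambda>\<omega>. Y j \<omega> * Y j \<omega>) = \<nu>"
    and cross: "\<And>j k. j \<in> I \<Longrightarrow> k \<in> I \<Longrightarrow> j \<noteq> k \<Longrightarrow>
      expectation (\<lambda>\<omega>. Y j \<omega> * Y k \<omega>) = \<mu>\<^sup>2"
  shows "expectation (\<lambda>\<omega>. ((\<Sum>j\<in>I. Y j \<omega>) - c)\<^sup>2) =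
    real (card I) * \<nu> + real (card I) * (real (card I) - 1) * \<mu>\<^sup>2 - 2 * c * real (card I) * \<mu> + c\<^sup>2"
proof -
  have expand: "((\<Sum>j\<in>I. Y j \<omega>) - c)\<^sup>2 =
      (\<Sum>j\<in>I. \<Sum>k\<in>I. Y j \<omega> * Y k \<omega>) - 2 * c * (\<Sum>j\<in>I. Y j \<omega>) + c\<^sup>2" for \<omega>
  proof -
    have "(\<Sum>j\<in>I. Y j \<omega>)\<^sup>2 = (\<Sum>j\<in>I. \<Sum>k\<in>I. Y j \<omega> * Y k \<omega>)"
      by (simp add: power2_eq_square sum_product)
    then show ?thesis unfolding power2_diff by simp
  qed
  have row: "(\<Sum>k\<in>I. expectation (\<lambda>\<omega>. Y j \<omega> * Y k \<omega>)) = \<nu> + (real (card I) - 1) * \<mu>\<^sup>2"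
    if j: "j \<in> I" for j
  proof -
    have "(\<Sum>k\<in>I. expectation (\<lambda>\<omega>. Y j \<omega> * Y k \<omega>)) =
        \<nu> + (\<Sum>k\<in>I - {j}. expectation (\<lambda>\<omega>. Y j \<omega> * Y k \<omega>))"
      using j fin by (simp add: sum.remove sq)
    also have "(\<Sum>k\<in>I - {j}. expectation (\<lambda>\<omega>. Y j \<omega> * Y k \<omega>)) = (\<Sum>k\<in>I - {j}. \<mu>\<^sup>2)"
      using j by (intro sum.cong refl cross) auto
    also have "\<dots> = (real (card I) - 1) * \<mu>\<^sup>2"
    proof -
      \<comment> \<open>Positivity lets the natural subtraction \<open>card I - 1\<close> pass
        through \<open>real\<close>.\<close>
      have "0 < card I" using j fin by (auto simp: card_gt_0_iff)
      then show ?thesis using j fin by (simp add: of_nat_diff Suc_le_eq)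
    qed
    finally show ?thesis .
  qed
  have "expectation (\<lambda>\<omega>. ((\<Sum>j\<in>I. Y j \<omega>) - c)\<^sup>2) =
      (\<Sum>j\<in>I. \<Sum>k\<in>I. expectation (\<lambda>\<omega>. Y j \<omega> * Y k \<omega>)) - 2 * c * (\<Sum>j\<in>I. expectation (Y j)) + c\<^sup>2"
  proof -
    have "integrable M (\<lambda>\<omega>. \<Sum>j\<in>I. \<Sum>k\<in>I. Y j \<omega> * Y k \<omega>)"
      by (intro Bochner_Integration.integrable_sum int2)
    moreover have "integrable M (\<lambda>\<omega>. \<Sum>j\<in>I. Y j \<omega>)"
      by (intro Bochner_Integration.integrable_sum int)
    moreover have "expectation (\<lambda>\<omega>. \<Sum>j\<in>I. \<Sum>k\<in>I. Y j \<omega> * Y k \<omega>) =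
        (\<Sum>j\<in>I. \<Sum>k\<in>I. expectation (\<lambda>\<omega>. Y j \<omega> * Y k \<omega>))"
      by (subst Bochner_Integration.integral_sum, intro Bochner_Integration.integrable_sum int2, assumption+)
        (intro sum.cong refl Bochner_Integration.integral_sum int2)
    moreover have "expectation (\<lambda>\<omega>. \<Sum>j\<in>I. Y j \<omega>) = (\<Sum>j\<in>I. expectation (Y j))"
      by (intro Bochner_Integration.integral_sum int)
    ultimately show ?thesis
      unfolding expand by (simp add: prob_space)
  qed
  also have "\<dots> = real (card I) * (\<nu> + (real (card I) - 1) * \<mu>\<^sup>2) - 2 * c * (real (card I) * \<mu>) + c\<^sup>2"
    by (simp add: row mean)
  finally show ?thesis by (simp add: algebra_simps)
qed

text \<open>Product rule of independent families, restricted to the two-element family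
  \<open>{j, k}\<close>.\<close>

lemma indep_vars_expectation_mult:
  fixes Y :: "'i \<Rightarrow> 'a \<Rightarrow> real"
  assumes "indep_vars (\<lambda>_. borel) Y I" "j \<in> I" "k \<in> I" "j \<noteq> k"
    "integrable M (Y j)" "integrable M (Y k)"
  shows "expectation (\<lambda>\<omega>. Y j \<omega> * Y k \<omega>) = expectation (Y j) * expectation (Y k)"
    and "integrable M (\<lambda>\<omega>. Y j \<omega> * Y k \<omega>)"
proof -
  have *: "indep_vars (\<lambda>_. borel) Y {j, k}"
    by (rule indep_vars_subset[OF assms(1)]) (use assms in auto)
  have "expectation (\<lambda>\<omega>. \<Prod>l\<in>{j, k}. Y l \<omega>) = (\<Prod>l\<in>{j, k}. expectation (Y l))"
    by (rule indep_vars_lebesgue_integral[OF _ *]) (use assms in auto)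
  then show "expectation (\<lambda>\<omega>. Y j \<omega> * Y k \<omega>) = expectation (Y j) * expectation (Y k)"
    using assms by simp
  have "integrable M (\<lambda>\<omega>. \<Prod>l\<in>{j, k}. Y l \<omega>)"
    by (rule indep_vars_integrable[OF _ *]) (use assms in auto)
  then show "integrable M (\<lambda>\<omega>. Y j \<omega> * Y k \<omega>)"
    using assms by simp
qed

text \<open>The library notion of two independent variables forces both to have the same type, whence the
  detour through sigma-algebras.\<close>

lemma indep_var_compose_vimage_algebra:
  assumes indep: "indep_set (sets (vimage_algebra (space M) U A)) (sets (vimage_algebra (space M) V B))"
    and U: "U \<in> M \<rightarrow>\<^sub>M A" and V: "V \<in> M \<rightarrow>\<^sub>M B" and f: "f \<in> A \<rightarrow>\<^sub>M C" and g: "g \<in> B \<rightarrow>\<^sub>M D"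
  shows "indep_var C (\<lambda>\<omega>. f (U \<omega>)) D (\<lambda>\<omega>. g (V \<omega>))"
proof -
  \<comment> \<open>Composing with a measurable map can only shrink the generated sigma-algebra, and
    independence passes to smaller ones.\<close>
  have sub: "sigma_sets (space M) {(\<lambda>\<omega>. k (W \<omega>)) -` S \<inter> space M | S. S \<in> sets L}
      \<subseteq> sets (vimage_algebra (space M) W K)"
    if W: "W \<in> M \<rightarrow>\<^sub>M K" and k: "k \<in> K \<rightarrow>\<^sub>M L" for W :: "'a \<Rightarrow> 'k" and K k and L :: "'l measure"
    unfolding sets_vimage_algebra
  proof (rule sigma_sets_mono', safe)
    fix S assume "S \<in> sets L"
    then have "k -` S \<inter> space K \<in> sets K" by (rule measurable_sets[OF k])
    moreover have "(\<lambda>\<omega>. k (W \<omega>)) -` S \<inter> space M = W -` (k -` S \<inter> space K) \<inter> space M"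
      using measurable_space[OF W] by auto
    ultimately show "\<exists>S'. (\<lambda>\<omega>. k (W \<omega>)) -` S \<inter> space M = W -` S' \<inter> space M \<and> S' \<in> sets K"
      by blast
  qed
  have "indep_set (sigma_sets (space M) {(\<lambda>\<omega>. f (U \<omega>)) -` S \<inter> space M | S. S \<in> sets C})
      (sigma_sets (space M) {(\<lambda>\<omega>. g (V \<omega>)) -` S \<inter> space M | S. S \<in> sets D})"
    using indep sub[OF U f] sub[OF V g] unfolding indep_sets2_eq by blast
  then show ?thesis
    unfolding indep_var_eq using measurable_compose[OF U f] measurable_compose[OF V g] by blast
qed

end

text \<open>Completing the square: in the difference of squares the terms
  \<open>(1 - k)\<^sup>2\<close> cancel and a factor \<open>n - 1\<close> comes out, which removes
  the denominator.\<close>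

lemma committed_flexibility_identity:
  fixes n p m1 m2 c :: real
  assumes "n \<noteq> 1" "c \<noteq> 0" "m1 \<noteq> 0"
  shows "(n * (p * m2) + n * (n - 1) * (p * m1)\<^sup>2 - 2 * c * n * (p * m1) + c\<^sup>2) / c\<^sup>2 =
    n / (n - 1) * (1 - m2 / (2 * c * m1) - p * (n - 1) * m1 / c)\<^sup>2
      - n / (n - 1) * (1 - m2 / (2 * c * m1))\<^sup>2 + 1"
proof -
  define k where "k = m2 / (2 * c * m1)"
  define q where "q = p * m1 / c"
  \<comment> \<open>The prefactor stays a free \<open>r\<close>, so this is a polynomial identity
    without division.\<close>
  have "r * (1 - k - (n - 1) * q)\<^sup>2 - r * (1 - k)\<^sup>2 + 1
      = r * ((n - 1) * ((n - 1) * q\<^sup>2 - 2 * (1 - k) * q)) + 1" for r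
    by (simp add: power2_eq_square algebra_simps)
  then have "n / (n - 1) * (1 - k - (n - 1) * q)\<^sup>2 - n / (n - 1) * (1 - k)\<^sup>2 + 1
      = n / (n - 1) * ((n - 1) * ((n - 1) * q\<^sup>2 - 2 * (1 - k) * q)) + 1" .
  also have "\<dots> = n * ((n - 1) * q\<^sup>2 - 2 * (1 - k) * q) + 1"
    using assms by simp
  also have "\<dots> = n * (n - 1) * q\<^sup>2 + 2 * n * (k * q) - 2 * n * q + 1"
    by (simp add: algebra_simps)
  \<comment> \<open>Here the mean \<open>m1\<close> cancels: this is the source of the quotient of
    moments in the formula.\<close>
  also have "k * q = p * m2 / (2 * c\<^sup>2)"
    using assms by (simp add: k_def q_def field_simps power2_eq_square)
  also have "n * (n - 1) * q\<^sup>2 + 2 * n * (p * m2 / (2 * c\<^sup>2)) - 2 * n * q + 1 =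
      (n * (p * m2) + n * (n - 1) * (p * m1)\<^sup>2 - 2 * c * n * (p * m1) + c\<^sup>2) / c\<^sup>2"
    using assms by (simp add: q_def field_simps power2_eq_square)
  finally show ?thesis by (simp add: k_def q_def mult_ac)
qed

section \<open>The expected squared relative error\<close>

theorem lemma2:
  fixes M :: "'w measure" and N :: nat and t0 tf Pbar :: real
    and X :: "nat \<Rightarrow> 'w \<Rightarrow> ewh" and P :: "nat \<Rightarrow> 'w \<Rightarrow> real"
    and T s :: "nat \<Rightarrow> 'w \<Rightarrow> real \<Rightarrow> real"
    and \<omega>0 :: 'w and t :: real and i :: nat
  assumes "prob_space M" and "2 \<le> N" and "t0 < tf" and "0 < Pbar"
    and data: "\<forall>j\<in>{1..N}. \<forall>\<omega>\<in>space M. admissible t0 tf (X j \<omega>) \<and> 0 < P j \<omega>"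
    and temperature: "\<forall>j\<in>{1..N}. \<forall>\<omega>\<in>space M. temperature_dynamics t0 tf (X j \<omega>) (T j \<omega>) (s j \<omega>)"
    and switching: "\<forall>j\<in>{1..N}. \<forall>\<omega>\<in>space M. switching_rule t0 tf (X j \<omega>) (T j \<omega>) (s j \<omega>)"
    and A1: "iid_heaters M N X P"
    and A2: "\<forall>j\<in>{1..N}. \<forall>\<omega>\<in>space M. at_most_one_switch t0 tf (s j \<omega>)"
    and second_moment: "\<forall>j\<in>{1..N}. integrable M (\<lambda>\<omega>. (P j \<omega>)^2)"
    and reported: "\<omega>0 \<in> space M"
      "\<forall>j\<in>{1..N}. p_on M N s j t0 = real (card (on_set N s t0 \<omega>0)) / real N"
    and "t \<in> {t0..<tf}" and "i \<in> {1..N}"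
  shows "prob_space.expectation M (\<lambda>\<omega>. (relative_error N P s Pbar t \<omega>)^2) =
      real N / (real N - 1) *
        (1 - prob_space.expectation M (\<lambda>\<omega>. (P i \<omega>)^2) / (2 * Pbar * prob_space.expectation M (P i))
           - p_on M N s i t * (real N - 1) * prob_space.expectation M (P i) / Pbar)^2
      - real N / (real N - 1) *
        (1 - prob_space.expectation M (\<lambda>\<omega>. (P i \<omega>)^2) / (2 * Pbar * prob_space.expectation M (P i)))^2
      + 1"
proof -
  interpret prob_space M by fact
  note t = \<open>t \<in> {t0..<tf}\<close> and i = \<open>i \<in> {1..N}\<close>
  define S where "S = switching_state t0 t"
  have [measurable]: "S \<in> borel_measurable ewh_space" unfolding S_def by measurable
  define m1 where "m1 = expectation (P i)"
  define m2 where "m2 = expectation (\<lambda>\<omega>. (P i \<omega>)\<^sup>2)"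
  define p where "p = p_on M N s i t"
  have state: "s j \<omega> t = S (X j \<omega>)" if "j \<in> {1..N}" "\<omega> \<in> space M" for j \<omega>
    unfolding S_def using that data temperature switching A2 t
    by (intro switching_state_correct[where tf = tf and T = "T j \<omega>"]) auto
  have S01: "S (X j \<omega>) \<in> {0, 1}" if "j \<in> {1..N}" "\<omega> \<in> space M" for j \<omega>
    using switching that t unfolding state[OF that, symmetric] switching_rule_def by auto
  have pair [measurable]: "(\<lambda>\<omega>. (X j \<omega>, P j \<omega>)) \<in> M \<rightarrow>\<^sub>M ewh_space \<Otimes>\<^sub>M borel" if "j \<in> {1..N}" for j
    using A1 that unfolding iid_heaters_def indep_vars_def by auto
  have X: "X j \<in> M \<rightarrow>\<^sub>M ewh_space" and P: "P j \<in> borel_measurable M" if "j \<in> {1..N}" for j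
    using measurable_compose[OF pair[OF that] measurable_fst]
      measurable_compose[OF pair[OF that] measurable_snd] by simp_all
  \<comment> \<open>Transfers expectations from heater \<open>j\<close> to the reference heater
    \<open>i\<close>, through the joint law of data and power.\<close>
  have same: "expectation (\<lambda>\<omega>. g (X j \<omega>, P j \<omega>)) = expectation (\<lambda>\<omega>. g (X i \<omega>, P i \<omega>))"
    if j: "j \<in> {1..N}" and g: "g \<in> borel_measurable (ewh_space \<Otimes>\<^sub>M borel)"
    for j and g :: "ewh \<times> real \<Rightarrow> real"
  proof -
    have "distr M (ewh_space \<Otimes>\<^sub>M borel) (\<lambda>\<omega>. (X j \<omega>, P j \<omega>)) =
        distr M (ewh_space \<Otimes>\<^sub>M borel) (\<lambda>\<omega>. (X i \<omega>, P i \<omega>))"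
      using A1 i j unfolding iid_heaters_def by blast
    then show ?thesis
      using integral_distr[OF pair[OF j] g] integral_distr[OF pair[OF i] g] by simp
  qed
  have P2_int: "integrable M (\<lambda>\<omega>. (P j \<omega>)\<^sup>2)" if "j \<in> {1..N}" for j
    using second_moment that by blast
  have P_int: "integrable M (P j)" if "j \<in> {1..N}" for j
    by (rule square_integrable_imp_integrable[OF P[OF that] P2_int[OF that]])
  have P_mean: "expectation (P j) = m1" and P2_mean: "expectation (\<lambda>\<omega>. (P j \<omega>)\<^sup>2) = m2"
    if "j \<in> {1..N}" for j
    using same[OF that, of snd] same[OF that, of "\<lambda>x. (snd x)\<^sup>2"] by (simp_all add: m1_def m2_def)
  have S_meas: "(\<lambda>\<omega>. S (X j \<omega>)) \<in> borel_measurable M" if "j \<in> {1..N}" for j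
    using X[OF that] by measurable
  have S_int: "integrable M (\<lambda>\<omega>. S (X j \<omega>))" if "j \<in> {1..N}" for j
    using S_meas[OF that] S01[OF that]
    by (intro integrable_const_bound[where B = 1] AE_I2) fastforce+
  have S_mean: "expectation (\<lambda>\<omega>. S (X j \<omega>)) = p" if j: "j \<in> {1..N}" for j
  proof -
    have "expectation (\<lambda>\<omega>. S (X j \<omega>)) = expectation (\<lambda>\<omega>. S (X i \<omega>))"
      using same[OF j, of "\<lambda>x. S (fst x)"] by simp
    also have "\<dots> = expectation (indicator {\<omega> \<in> space M. i \<in> on_set N s t \<omega>})"
    proof (rule Bochner_Integration.integral_cong)
      fix \<omega> assume "\<omega> \<in> space M"
      then show "S (X i \<omega>) = indicator {\<omega> \<in> space M. i \<in> on_set N s t \<omega>} \<omega>"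
        using S01[OF i] state[OF i] i by (auto simp: on_set_def indicator_def)
    qed simp
    also have "\<dots> = p"
      by (simp add: p_def p_on_def Int_def conj_commute)
    finally show ?thesis .
  qed
  \<comment> \<open>Stated for general \<open>h\<close>: the identity gives the mean of a
    consumption and the square its second moment.\<close>
  have SP_indep: "expectation (\<lambda>\<omega>. S (X j \<omega>) * h (P j \<omega>)) = p * expectation (\<lambda>\<omega>. h (P j \<omega>))"
      "integrable M (\<lambda>\<omega>. S (X j \<omega>) * h (P j \<omega>))"
    if j: "j \<in> {1..N}" and h [measurable]: "h \<in> borel_measurable borel"
      and h_int: "integrable M (\<lambda>\<omega>. h (P j \<omega>))" for j and h :: "real \<Rightarrow> real"
  proof -
    have "indep_set (sets (vimage_algebra (space M) (X j) ewh_space))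
        (sets (vimage_algebra (space M) (P j) borel))"
      using A1 j unfolding iid_heaters_def by blast
    then have *: "indep_var borel (\<lambda>\<omega>. S (X j \<omega>)) borel (\<lambda>\<omega>. h (P j \<omega>))"
      by (rule indep_var_compose_vimage_algebra[OF _ X[OF j] P[OF j]]) measurable
    show "expectation (\<lambda>\<omega>. S (X j \<omega>) * h (P j \<omega>)) = p * expectation (\<lambda>\<omega>. h (P j \<omega>))"
      unfolding indep_var_lebesgue_integral[OF * S_int[OF j] h_int] S_mean[OF j] ..
    show "integrable M (\<lambda>\<omega>. S (X j \<omega>) * h (P j \<omega>))"
      by (rule indep_var_integrable[OF * S_int[OF j] h_int])
  qed
  define Y where "Y j \<omega> = S (X j \<omega>) * P j \<omega>" for j \<omega>
  have Y_int: "integrable M (Y j)" and Y_mean: "expectation (Y j) = p * m1" if "j \<in> {1..N}" for j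
    using SP_indep[OF that, of "\<lambda>x. x"] P_int[OF that] P_mean[OF that] by (simp_all add: Y_def[abs_def])
  \<comment> \<open>A state in \<open>{0, 1}\<close> equals its square, so the second moment carries
    \<open>p\<close> and not \<open>p\<^sup>2\<close>.\<close>
  have Y_sq: "Y j \<omega> * Y j \<omega> = S (X j \<omega>) * (P j \<omega>)\<^sup>2" if "j \<in> {1..N}" "\<omega> \<in> space M" for j \<omega>
    using S01[OF that] by (auto simp: Y_def power2_eq_square)
  have YY_int: "integrable M (\<lambda>\<omega>. Y j \<omega> * Y j \<omega>)"
    and YY_mean: "expectation (\<lambda>\<omega>. Y j \<omega> * Y j \<omega>) = p * m2" if j: "j \<in> {1..N}" for j
  proof -
    note * = SP_indep[OF j, of "\<lambda>x. x\<^sup>2"]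
    have "integrable M (\<lambda>\<omega>. Y j \<omega> * Y j \<omega>) \<longleftrightarrow> integrable M (\<lambda>\<omega>. S (X j \<omega>) * (P j \<omega>)\<^sup>2)"
      by (intro Bochner_Integration.integrable_cong refl Y_sq j)
    then show "integrable M (\<lambda>\<omega>. Y j \<omega> * Y j \<omega>)"
      using *(2) P2_int[OF j] by simp
    have "expectation (\<lambda>\<omega>. Y j \<omega> * Y j \<omega>) = expectation (\<lambda>\<omega>. S (X j \<omega>) * (P j \<omega>)\<^sup>2)"
      by (intro Bochner_Integration.integral_cong refl Y_sq j)
    then show "expectation (\<lambda>\<omega>. Y j \<omega> * Y j \<omega>) = p * m2"
      using *(1) P2_int[OF j] P2_mean[OF j] by simp
  qed
  \<comment> \<open>Each consumption is a measurable function of the pair of data and power, and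
    these pairs are independent across heaters.\<close>
  have "indep_vars (\<lambda>_. borel) (\<lambda>j \<omega>. (\<lambda>x. S (fst x) * snd x) (X j \<omega>, P j \<omega>)) {1..N}"
    by (rule indep_vars_compose2[where M' = "\<lambda>_. ewh_space \<Otimes>\<^sub>M borel"])
      (use A1 in \<open>auto simp: iid_heaters_def\<close>)
  then have Y_indep: "indep_vars (\<lambda>_. borel) Y {1..N}" by (simp add: Y_def[abs_def])
  note Y_pair = indep_vars_expectation_mult[OF Y_indep _ _ _ Y_int Y_int]
  \<comment> \<open>The algebraic identity divides by the mean power.\<close>
  have m1_pos: "0 < m1"
  proof -
    have "AE \<omega> in M. 0 < P i \<omega>" using data i by (intro AE_I2) auto
    then show ?thesis
      unfolding m1_def by (rule expectation_greater[OF P_int[OF i]])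
  qed
  \<comment> \<open>Squaring removes the absolute value, and the constant denominator then leaves
    the expectation.\<close>
  have "expectation (\<lambda>\<omega>. (relative_error N P s Pbar t \<omega>)\<^sup>2) =
      expectation (\<lambda>\<omega>. ((\<Sum>j=1..N. Y j \<omega>) - Pbar)\<^sup>2 / Pbar\<^sup>2)"
    by (rule Bochner_Integration.integral_cong)
      (simp_all add: relative_error_def aggregate_power_def Y_def state power_divide)
  also have "\<dots> = expectation (\<lambda>\<omega>. ((\<Sum>j=1..N. Y j \<omega>) - Pbar)\<^sup>2) / Pbar\<^sup>2" by simp
  also have "expectation (\<lambda>\<omega>. ((\<Sum>j=1..N. Y j \<omega>) - Pbar)\<^sup>2) =
      real N * (p * m2) + real N * (real N - 1) * (p * m1)\<^sup>2 - 2 * Pbar * real N * (p * m1) + Pbar\<^sup>2"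
  proof (rule expectation_square_sum_minus[where I = "{1..N}", simplified card_atLeastAtMost diff_Suc_1])
    fix j k assume jk: "j \<in> {1..N}" "k \<in> {1..N}"
    show "integrable M (\<lambda>\<omega>. Y j \<omega> * Y k \<omega>)"
      using Y_pair(2)[OF jk _ jk] YY_int[OF jk(1)] by (cases "j = k") auto
    show "expectation (\<lambda>\<omega>. Y j \<omega> * Y k \<omega>) = (p * m1)\<^sup>2" if "j \<noteq> k"
      using Y_pair(1)[OF jk that jk] Y_mean jk by (simp add: power2_eq_square)
  qed (use Y_int Y_mean YY_mean in auto)
  finally show ?thesis
    using committed_flexibility_identity[of "real N" Pbar m1 p m2] m1_pos \<open>0 < Pbar\<close> \<open>2 \<le> N\<close>
    by (simp add: m1_def m2_def p_def)
qed

end
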